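(* Let $n\ge 2$ and let $Q_+^n$ be the Cayley graph of $\mathbb{Z}_2^n$ with generating set $\{e_1,\ldots,e_n,E_n\}$, where $e_i$ is the vector of Hamming weight $1$ with a $1$ in its $i$th coordinate and $E_n=\sum_{k=1}^n e_k$ is the all-ones vector. Then $Q_+^n$ has an orthogonal signing if and only if $n\equiv 0,3 \pmod 4$. In particular, for $n\equiv 1,2\pmod 4$, $Q_+^n$ has a unitary signing but no orthogonal signing.
   Context: For $S \subseteq \mathbb{Z}_2^n$, the Cayley graph of $\mathbb{Z}_2^n$ with generating set $S$ has vertex set $\mathbb{Z}_2^n$ and edge set consisting of all unordered pairs $\{g,g+s\}$ with $g\in\mathbb{Z}_2^n$, $s\in S$. A unitary signing of a graph is a Hermitian matrix obtained from the adjacency matrix of the graph by replacing each nonzero entry by a complex number of absolute value $1$, so that the complex inner product of any two distinct rows is $0$. If all nonzero entries are real (that is, each is $+1$ or $-1$), the signing is called an orthogonal signing. *)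

theory Defs
  imports "HOL-Analysis.Analysis" "HOL-Library.Z2"
begin

instance bit :: finite
proof
  have "(UNIV :: bit set) = {0, 1}"
    by (auto simp: bit_not_one_iff)
  then show "finite (UNIV :: bit set)"
    by (metis finite.emptyI finite.insertI)
qed

text \<open>
  The group of binary vectors of length \<open>n\<close> is the type \<open>bit ^ 'n\<close> with \<open>n = CARD('n)\<close>.
  A graph on the vertex set \<open>UNIV :: 'v set\<close> is given by its set of edges, each edge being the
  set of its end points.
\<close>

definition cayley_edges :: "(bit ^ 'n) set \<Rightarrow> (bit ^ 'n) set set"
  where "cayley_edges S = {{g, g + s} | g s. s \<in> S}"

definition adjacency_matrix :: "'v::finite set set \<Rightarrow> complex ^ 'v ^ 'v"
  where "adjacency_matrix E = (\<chi> u v. if {u, v} \<in> E then 1 else 0)"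

definition hermitian_matrix :: "complex ^ 'v ^ 'v \<Rightarrow> bool"
  where "hermitian_matrix M \<longleftrightarrow> (\<forall>u v. M $ u $ v = cnj (M $ v $ u))"

text \<open>The inner product \<open>x \<bullet> y\<close> of the library is only the real part of the following one.\<close>

definition complex_inner :: "complex ^ 'v \<Rightarrow> complex ^ 'v \<Rightarrow> complex"
  where "complex_inner x y = (\<Sum>i\<in>UNIV. x $ i * cnj (y $ i))"

definition unitary_signing :: "'v::finite set set \<Rightarrow> complex ^ 'v ^ 'v \<Rightarrow> bool"
  where "unitary_signing E M \<longleftrightarrow>
    hermitian_matrix M \<and>
    (\<forall>u v. if adjacency_matrix E $ u $ v \<noteq> 0 then cmod (M $ u $ v) = 1 else M $ u $ v = 0) \<and>
    (\<forall>u v. u \<noteq> v \<longrightarrow> complex_inner (row u M) (row v M) = 0)"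

definition orthogonal_signing :: "'v::finite set set \<Rightarrow> complex ^ 'v ^ 'v \<Rightarrow> bool"
  where "orthogonal_signing E M \<longleftrightarrow>
    unitary_signing E M \<and> (\<forall>u v. M $ u $ v \<noteq> 0 \<longrightarrow> M $ u $ v \<in> \<real>)"

definition unit_vec :: "'n::finite \<Rightarrow> bit ^ 'n"
  where "unit_vec i = axis i 1"

definition all_ones :: "bit ^ 'n"
  where "all_ones = (\<Sum>k\<in>UNIV. unit_vec k)"

text \<open>
  The graph \<open>Q\<^sub>+\<^sup>n\<close>. The argument only fixes the index type, whose cardinality is \<open>n\<close>.
\<close>

definition Q_plus :: "'n::finite itself \<Rightarrow> (bit ^ 'n) set set"
  where "Q_plus _ = cayley_edges (range unit_vec \<union> {all_ones})"

end

theory Submission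
  imports Defs
begin

text \<open>
  For \<open>n \<noteq> 3\<close>, vertices differing by a sum of two distinct generators have exactly two common
  neighbours, so under an orthogonal signing the sign of a walk is negated whenever two consecutive
  different steps are interchanged. Reversing the closed
  walk that uses each of the \<open>n + 1\<close> generators once takes \<open>n (n + 1) / 2\<close> such interchanges, but
  leaves its sign unchanged by symmetry; hence \<open>n (n + 1) / 2\<close> is even. Conversely, pairwise
  anticommuting Hermitian Pauli operators translating by the generators add up to a unitary
  signing; all of them can be chosen real except the one translating by the all-ones vector, which
  needs a factor \<open>\<i>\<close> exactly when \<open>(n + 1) div 2\<close> is odd.
\<close>

text \<open>Addition on \<open>bit\<close> stays \<open>+\<close> under simp, the form in which the
  group laws and \<open>bit_sign_add\<close> are stated.\<close>

declare add_bit_eq_xor [simp del]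

section \<open>Binary vectors and the edges of a Cayley graph\<close>

lemma of_nat_bit: "of_nat k = (of_bool (odd k) :: bit)"
  by (induction k) auto

lemma bit_vec_add_self [simp]: "x + x = (0 :: bit ^ 'n)"
  by (simp add: vec_eq_iff)

lemma bit_vec_add_self_left [simp]: "x + (x + y) = (y :: bit ^ 'n)"
  by (simp flip: add.assoc)

lemma bit_vec_add_eq_0_iff: "x + y = 0 \<longleftrightarrow> x = (y :: bit ^ 'n)"
  by (metis bit_vec_add_self bit_vec_add_self_left add_0_right)

text \<open>Each vector is its own inverse, so the step between two vertices is their sum in either
  direction.\<close>

lemma cayley_edges_iff: "{u, v} \<in> cayley_edges S \<longleftrightarrow> u + v \<in> S"
proof
  assume "{u, v} \<in> cayley_edges S"
  then obtain g s where "{u, v} = {g, g + s}" "s \<in> S"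
    unfolding cayley_edges_def by blast
  then show "u + v \<in> S"
    by (auto simp: doubleton_eq_iff add_ac)
next
  assume "u + v \<in> S"
  moreover have "{u, v} = {u, u + (u + v)}"
    by simp
  ultimately show "{u, v} \<in> cayley_edges S"
    unfolding cayley_edges_def by blast
qed

lemma adjacency_cayley_edges_iff:
  "adjacency_matrix (cayley_edges S) $ u $ v \<noteq> 0 \<longleftrightarrow> u + v \<in> S"
  by (simp add: adjacency_matrix_def cayley_edges_iff)


section \<open>Signings from bilinear forms\<close>

definition bit_sign :: "bit \<Rightarrow> complex"
  where "bit_sign b = (if b = 0 then 1 else -1)"

lemma bit_sign_add: "bit_sign (a + b) = bit_sign a * bit_sign b"
  by (cases a; cases b) (auto simp: bit_sign_def)

lemma bit_sign_simps [simp]: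
  "bit_sign 0 = 1" "bit_sign 1 = -1" "cmod (bit_sign b) = 1" "cnj (bit_sign b) = bit_sign b"
  "bit_sign b \<in> \<real>"
  by (auto simp: bit_sign_def)

text \<open>The phase makes the translation by \<open>s\<close> with signs \<open>bit_sign (\<beta> s u)\<close> Hermitian.\<close>

definition form_signing ::
    "(bit ^ 'n) set \<Rightarrow> (bit ^ 'n \<Rightarrow> bit ^ 'n \<Rightarrow> bit) \<Rightarrow> complex ^ (bit ^ 'n) ^ (bit ^ 'n)"
  where "form_signing S \<beta> = (\<chi> u v.
    if u + v \<in> S
    then (if \<beta> (u + v) (u + v) = 0 then 1 else \<i>) * bit_sign (\<beta> (u + v) u)
    else 0)"

text \<open>Exchanging \<open>s\<close> and \<open>t\<close> changes the sign by
  \<open>bit_sign (\<beta> s t + \<beta> t s)\<close>, so \<open>anticommute\<close> makes the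
  signed translations by distinct generators anticommute.\<close>

context
  fixes S :: "(bit ^ 'n::finite) set" and \<beta> :: "bit ^ 'n \<Rightarrow> bit ^ 'n \<Rightarrow> bit"
  assumes additive: "\<And>s u v. s \<in> S \<Longrightarrow> \<beta> s (u + v) = \<beta> s u + \<beta> s v"
    and anticommute: "\<And>s t. s \<in> S \<Longrightarrow> t \<in> S \<Longrightarrow> s \<noteq> t \<Longrightarrow> \<beta> s t + \<beta> t s = 1"
begin

text \<open>Reading an edge of step \<open>s\<close> from its other end changes the sign by
  \<open>bit_sign (\<beta> s s)\<close>; when this is -1, the phase is \<i>, which conjugation
  negates too.\<close>

lemma form_signing_hermitian: "hermitian_matrix (form_signing S \<beta>)"
  unfolding hermitian_matrix_def
proof (intro allI)
  fix u v :: "bit ^ 'n"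
  have "\<beta> (u + v) v = \<beta> (u + v) (u + v) + \<beta> (u + v) u" if "u + v \<in> S"
    using additive[OF that, of "u + v" u] by (simp add: add_ac)
  then show "form_signing S \<beta> $ u $ v = cnj (form_signing S \<beta> $ v $ u)"
    by (auto simp: form_signing_def add.commute[of v u] bit_sign_add)
qed

lemma form_signing_square_off_diagonal:
  assumes "u \<noteq> v"
  shows "(\<Sum>x\<in>UNIV. form_signing S \<beta> $ u $ x * form_signing S \<beta> $ x $ v) = 0" (is "sum ?f _ = 0")
proof -
  \<comment> \<open>The two paths \<open>u, u + s, v\<close> and \<open>u, u + t, v\<close> cancel.\<close>
  have "?f (u + v + x) = - ?f x" for x
  proof (cases "u + x \<in> S \<and> x + v \<in> S")
    case True
    define s t where "s = u + x" and "t = x + v"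
    have *: "s \<in> S" "t \<in> S" "s \<noteq> t"
      using True assms by (auto simp: s_def t_def add.commute[of u])
    have eqs: "x = u + s" "v = u + s + t"
      by (simp_all add: s_def t_def add_ac)
    have "bit_sign (\<beta> s t) = - bit_sign (\<beta> t s)"
      using anticommute[OF *] by (cases "\<beta> s t"; cases "\<beta> t s") auto
    then show ?thesis
      using * by (simp add: eqs form_signing_def add_ac additive bit_sign_add)
  next
    case False
    \<comment> \<open>The shift by \<open>u + v\<close> exchanges the two memberships, so both
      summands vanish.\<close>
    then show ?thesis
      by (auto simp: form_signing_def add_ac)
  qed
  moreover have "sum ?f UNIV = (\<Sum>x\<in>UNIV. ?f (u + v + x))"
    by (rule sum.reindex_bij_witness[of _ "\<lambda>x. u + v + x" "\<lambda>x. u + v + x"])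
      (auto simp: add_ac)
  ultimately have "sum ?f UNIV = - sum ?f UNIV"
    by (simp only: sum_negf)
  then show ?thesis
    by simp
qed

text \<open>The matrix is Hermitian, so the inner products of its rows are the entries of its
  square.\<close>

lemma unitary_signing_form: "unitary_signing (cayley_edges S) (form_signing S \<beta>)"
proof -
  have "cnj (form_signing S \<beta> $ v $ x) = form_signing S \<beta> $ x $ v" for v x
    using form_signing_hermitian unfolding hermitian_matrix_def by metis
  then have "complex_inner (row u (form_signing S \<beta>)) (row v (form_signing S \<beta>)) =
      (\<Sum>x\<in>UNIV. form_signing S \<beta> $ u $ x * form_signing S \<beta> $ x $ v)" for u v
    by (simp add: complex_inner_def row_def)
  then show ?thesis
    unfolding unitary_signing_def adjacency_cayley_edges_iff
    using form_signing_hermitian form_signing_square_off_diagonal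
    by (auto simp: form_signing_def norm_mult)
qed

lemma orthogonal_signing_form:
  assumes "\<And>s. s \<in> S \<Longrightarrow> \<beta> s s = 0"
  shows "orthogonal_signing (cayley_edges S) (form_signing S \<beta>)"
  unfolding orthogonal_signing_def using unitary_signing_form assms
  by (auto simp: form_signing_def)

end


section \<open>Reversing closed walks\<close>

text \<open>A walk is given by its steps, so permuting the list keeps both end points.\<close>

primrec walk_weight ::
    "complex ^ (bit ^ 'n) ^ (bit ^ 'n) \<Rightarrow> bit ^ 'n \<Rightarrow> (bit ^ 'n) list \<Rightarrow> complex"
  where
    "walk_weight M u [] = 1"
  | "walk_weight M u (s # ss) = M $ u $ (u + s) * walk_weight M (u + s) ss"

lemma walk_weight_append:
  "walk_weight M u (xs @ ys) = walk_weight M u xs * walk_weight M (u + sum_list xs) ys"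
  by (induction xs arbitrary: u) (auto simp: add.assoc)

context
  fixes S :: "(bit ^ 'n::finite) set" and M :: "complex ^ (bit ^ 'n) ^ (bit ^ 'n)"
  assumes signing: "orthogonal_signing (cayley_edges S) M"
begin

lemma signing_symmetric: "M $ u $ v = M $ v $ u"
  using signing
  by (metis Reals_cnj_iff complex_cnj_zero hermitian_matrix_def orthogonal_signing_def
      unitary_signing_def)

lemma signing_real: "cnj (M $ u $ v) = M $ u $ v"
  using signing by (metis Reals_cnj_iff complex_cnj_zero orthogonal_signing_def)

lemma signing_eq_0_iff: "M $ u $ v = 0 \<longleftrightarrow> u + v \<notin> S"
  using signing unfolding orthogonal_signing_def unitary_signing_def adjacency_cayley_edges_iff
  by (metis norm_zero zero_neq_one)

lemma walk_weight_neq_0: "set xs \<subseteq> S \<Longrightarrow> walk_weight M u xs \<noteq> 0"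
  by (induction xs arbitrary: u) (auto simp: signing_eq_0_iff)

text \<open>The entries are symmetric, and the step back along a generator is that generator
  itself.\<close>

lemma walk_weight_reverse: "walk_weight M (u + sum_list xs) (rev xs) = walk_weight M u xs"
proof (induction xs arbitrary: u)
  case (Cons x xs)
  \<comment> \<open>The doubled sum vanishes: going back through \<open>xs\<close> ends at
    \<open>u + x\<close>, where the last step starts.\<close>
  have "walk_weight M (u + sum_list (x # xs)) (rev (x # xs)) =
      walk_weight M (u + x) xs * walk_weight M (u + x + (sum_list xs + sum_list xs)) [x]"
    using Cons[of "u + x"] unfolding rev.simps walk_weight_append
    by (simp add: add_ac sum_list_rev)
  then show ?case
    by (simp add: add_ac signing_symmetric[of "u + x"])
qed simp

text \<open>In the graph, \<open>unique_sums\<close> leaves \<open>u\<close> and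
  \<open>u + s + t\<close> no common neighbours besides \<open>u + s\<close> and
  \<open>u + t\<close>.\<close>

context
  assumes unique_sums: "\<And>s t s' t'. s \<in> S \<Longrightarrow> t \<in> S \<Longrightarrow> s' \<in> S \<Longrightarrow> t' \<in> S \<Longrightarrow>
    s \<noteq> t \<Longrightarrow> s + t = s' + t' \<Longrightarrow> s' = s \<or> s' = t"
begin

text \<open>The inner product of rows \<open>u\<close> and \<open>u + s + t\<close> has just two
  nonzero terms, one for each order of the steps.\<close>

lemma signing_quadrangle:
  assumes "s \<in> S" "t \<in> S" "s \<noteq> t"
  shows "M $ u $ (u + s) * M $ (u + s) $ (u + s + t) =
    - (M $ u $ (u + t) * M $ (u + t) $ (u + t + s))"
proof -
  define v where "v = u + s + t"
  let ?f = "\<lambda>x. M $ u $ x * M $ x $ v"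
  have "u \<noteq> v"
    using assms(3) by (metis v_def add.assoc add_cancel_right_right bit_vec_add_eq_0_iff)
  then have "complex_inner (row u M) (row v M) = 0"
    using signing unfolding orthogonal_signing_def unitary_signing_def by blast
  then have "(\<Sum>x\<in>UNIV. ?f x) = 0"
    by (simp add: complex_inner_def row_def signing_real signing_symmetric[of v])
  moreover have "(\<Sum>x\<in>UNIV. ?f x) = (\<Sum>x\<in>{u + s, u + t}. ?f x)"
  proof (rule sum.mono_neutral_right)
    show "\<forall>x\<in>UNIV - {u + s, u + t}. ?f x = 0"
    proof (rule ballI, rule ccontr)
      fix x assume x: "x \<in> UNIV - {u + s, u + t}" and "?f x \<noteq> 0"
      then have "u + x \<in> S" "x + v \<in> S"
        by (auto simp: signing_eq_0_iff)
      moreover have "s + t = (u + x) + (x + v)"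
        by (simp add: v_def add_ac)
      ultimately have "u + x = s \<or> u + x = t"
        using unique_sums[OF assms(1,2) _ _ assms(3)] by blast
      then show False
        using x by auto
    qed
  qed auto
  ultimately have "?f (u + s) + ?f (u + t) = 0"
    using assms(3) by simp
  then show ?thesis
    by (simp add: v_def add_eq_0_iff2 add_ac)
qed

text \<open>Each step that \<open>x\<close> passes flips the sign by
  \<open>signing_quadrangle\<close> and leaves the rest of the walk as it was.\<close>

lemma walk_weight_move:
  assumes "x \<in> S" "set xs \<subseteq> S" "x \<notin> set xs"
  shows "walk_weight M u (xs @ [x]) = (-1) ^ length xs * walk_weight M u (x # xs)"
  using assms(2,3)
proof (induction xs arbitrary: u)
  case (Cons y ys)
  have swap: "M $ u $ (u + y) * M $ (u + y) $ (u + y + x) =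
      - (M $ u $ (u + x) * M $ (u + x) $ (u + x + y))"
    using Cons.prems assms(1) by (intro signing_quadrangle) auto
  \<comment> \<open>The induction hypothesis brings \<open>x\<close> directly behind
    \<open>y\<close>; \<open>swap\<close> then exchanges these two.\<close>
  have "walk_weight M u ((y # ys) @ [x]) = (-1) ^ length ys *
      (M $ u $ (u + y) * M $ (u + y) $ (u + y + x) * walk_weight M (u + y + x) ys)"
    using Cons by simp
  also have "\<dots> = (-1) ^ length (y # ys) *
      (M $ u $ (u + x) * M $ (u + x) $ (u + x + y) * walk_weight M (u + x + y) ys)"
    unfolding swap by (simp add: add_ac)
  finally show ?case
    by (simp add: mult.assoc)
qed simp

text \<open>Reversal interchanges each pair of steps once; the induction moves the head from the end
  to the front.\<close>

lemma walk_weight_rev: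
  assumes "set xs \<subseteq> S" "distinct xs"
  shows "walk_weight M u (rev xs) = (-1) ^ (length xs choose 2) * walk_weight M u xs"
  using assms
proof (induction xs arbitrary: u)
  case (Cons x xs)
  have "walk_weight M u (rev (x # xs)) = (-1) ^ length xs * walk_weight M u (x # rev xs)"
    using walk_weight_move[of x "rev xs" u] Cons.prems by simp
  also have "\<dots> = (-1) ^ (length xs + (length xs choose 2)) * walk_weight M u (x # xs)"
    using Cons by (simp add: power_add)
  \<comment> \<open>Pascal's rule.\<close>
  also have "length xs + (length xs choose 2) = (length (x # xs) choose 2)"
    by (simp add: numeral_2_eq_2)
  finally show ?case .
qed (simp add: numeral_2_eq_2)

text \<open>The hypothesis closes the walk that uses each generator once, so
  \<open>walk_weight_reverse\<close> and \<open>walk_weight_rev\<close> speak of the same reversed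
  walk; its nonzero weight forces the sign to be 1.\<close>

lemma even_choose_2_if_orthogonal_signing:
  assumes "\<Sum>S = 0"
  shows "even (card S choose 2)"
proof -
  obtain xs where xs: "set xs = S" "distinct xs"
    using finite_distinct_list[of S] by auto
  then have "sum_list xs = 0"
    using assms sum_list_distinct_conv_sum_set[of xs id] by simp
  then have "walk_weight M 0 xs = (-1) ^ (card S choose 2) * walk_weight M 0 xs"
    using walk_weight_rev[of xs 0] walk_weight_reverse[of 0 xs] xs distinct_card[of xs] by simp
  then show ?thesis
    using walk_weight_neq_0[of xs 0] xs by (cases "even (card S choose 2)") auto
qed

end

end


section \<open>The generators of the graph\<close>

lemma unit_vec_nth: "unit_vec i $ j = (if j = i then 1 else 0)"
  by (simp add: unit_vec_def axis_def)

lemma unit_vec_eq_iff [simp]: "unit_vec i = unit_vec j \<longleftrightarrow> i = j"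
  by (simp add: unit_vec_def axis_eq_axis)

lemma all_ones_nth: "all_ones $ i = 1"
  by (simp add: all_ones_def unit_vec_nth)

lemma all_ones_notin_range_unit_vec:
  assumes "CARD('n::finite) \<ge> 2"
  shows "all_ones \<notin> range (unit_vec :: 'n \<Rightarrow> bit ^ 'n)"
proof
  assume "all_ones \<in> range (unit_vec :: 'n \<Rightarrow> bit ^ 'n)"
  then obtain i :: 'n where i: "all_ones = unit_vec i"
    by blast
  have "j = i" for j
    using arg_cong[OF i, of "\<lambda>v. v $ j"] by (simp add: all_ones_nth unit_vec_nth split: if_splits)
  then have "CARD('n) = card {i}"
    by (intro arg_cong[of _ _ card]) blast
  then show False
    using assms by simp
qed

definition Q_plus_generators :: "(bit ^ 'n::finite) set"
  where "Q_plus_generators = range unit_vec \<union> {all_ones}"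

lemma Q_plus_eq: "Q_plus TYPE('n::finite) = cayley_edges Q_plus_generators"
  by (simp add: Q_plus_def Q_plus_generators_def)

context
  assumes card_ge_2: "CARD('n::finite) \<ge> 2"
begin

lemma card_Q_plus_generators: "card (Q_plus_generators :: (bit ^ 'n) set) = CARD('n) + 1"
  using all_ones_notin_range_unit_vec[OF card_ge_2]
  by (simp add: Q_plus_generators_def card_image inj_def)

text \<open>Only \<open>all_ones\<close> and \<open>unit_vec i\<close> have a nonzero coordinate
  \<open>i\<close>.\<close>

lemma sum_generators_nth:
  fixes T :: "(bit ^ 'n) set"
  assumes "T \<subseteq> Q_plus_generators"
  shows "(\<Sum>T) $ i = of_bool (all_ones \<in> T) + of_bool (unit_vec i \<in> T)"
proof -
  have ne: "unit_vec j \<noteq> (all_ones :: bit ^ 'n)" for j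
    using all_ones_notin_range_unit_vec[OF card_ge_2] by (metis rangeI)
  have "(\<Sum>T) $ i = (\<Sum>v\<in>T. of_bool (v = all_ones) + of_bool (v = unit_vec i))"
    unfolding sum_component
  proof (rule sum.cong)
    fix v assume "v \<in> T"
    then consider "v = all_ones" | j where "v = unit_vec j"
      using assms unfolding Q_plus_generators_def by blast
    then show "v $ i = of_bool (v = all_ones) + of_bool (v = unit_vec i)"
    proof cases
      case 1
      then show ?thesis
        using ne[of i, symmetric] by (simp add: all_ones_nth)
    next
      case 2
      then show ?thesis
        using ne by (simp add: unit_vec_nth)
    qed
  qed simp
  also have "\<dots> = of_bool (all_ones \<in> T) + of_bool (unit_vec i \<in> T)"
    by (simp add: sum.distrib of_bool_def)
  finally show ?thesis .
qed

lemma sum_Q_plus_generators: "\<Sum>(Q_plus_generators :: (bit ^ 'n) set) = 0"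
  unfolding vec_eq_iff sum_generators_nth[OF subset_refl] by (simp add: Q_plus_generators_def)

text \<open>Coordinate \<open>i\<close> of the sum vanishes only if \<open>unit_vec i\<close> and
  \<open>all_ones\<close> are both in \<open>T\<close> or both outside.\<close>

lemma generators_dependent_imp_all:
  fixes T :: "(bit ^ 'n) set"
  assumes "T \<subseteq> Q_plus_generators" "\<Sum>T = 0" "T \<noteq> {}"
  shows "T = Q_plus_generators"
proof -
  have "all_ones \<in> T \<longleftrightarrow> unit_vec i \<in> T" for i
    using sum_generators_nth[OF assms(1), of i] assms(2)
    by (cases "all_ones \<in> T"; cases "unit_vec i \<in> T") auto
  then show ?thesis
    using assms(1,3) unfolding Q_plus_generators_def by blast
qed

text \<open>A second representation would give four distinct generators with sum 0, hence all
  \<open>CARD('n) + 1\<close> of them. In dimension 3 this happens: two unit vectors have the same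
  sum as the third and \<open>all_ones\<close>.\<close>

lemma generators_unique_sums:
  fixes s t s' t' :: "bit ^ 'n"
  assumes "CARD('n) \<noteq> 3"
    and S: "s \<in> Q_plus_generators" "t \<in> Q_plus_generators" "s' \<in> Q_plus_generators"
      "t' \<in> Q_plus_generators"
    and "s \<noteq> t" "s + t = s' + t'"
  shows "s' = s \<or> s' = t"
proof (rule ccontr)
  assume "\<not> (s' = s \<or> s' = t)"
  moreover from this have "t' \<noteq> s" "t' \<noteq> t" "s' \<noteq> t'"
    using assms(6,7) by (auto simp: add.commute bit_vec_add_eq_0_iff)
  ultimately have "\<Sum>{s, t, s', t'} = s + t + (s' + t')" and card: "card {s, t, s', t'} = 4"
    using assms(6) by (auto simp: add.assoc)
  then have "\<Sum>{s, t, s', t'} = 0"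
    using assms(7) by simp
  then have "{s, t, s', t'} = Q_plus_generators"
    using S by (intro generators_dependent_imp_all) auto
  then show False
    using card assms(1) card_Q_plus_generators by simp
qed

text \<open>
  Jordan--Wigner choice of signs along an enumeration \<open>h\<close> of the coordinates; the form of the
  all-ones vector is then forced by anticommutation.
\<close>

lemma exists_generator_form:
  obtains \<beta> :: "bit ^ 'n \<Rightarrow> bit ^ 'n \<Rightarrow> bit"
  where "\<And>s u v. \<beta> s (u + v) = \<beta> s u + \<beta> s v"
    and "\<And>s t. s \<in> Q_plus_generators \<Longrightarrow> t \<in> Q_plus_generators \<Longrightarrow> s \<noteq> t \<Longrightarrow> \<beta> s t + \<beta> t s = 1"
    and "\<And>i. \<beta> (unit_vec i) (unit_vec i) = 0"
    and "\<beta> all_ones all_ones = of_nat ((CARD('n) + 1) div 2)"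
proof -
  obtain h :: "'n \<Rightarrow> nat" where h: "bij_betw h UNIV {0..<CARD('n)}"
    using ex_bij_betw_finite_nat[of "UNIV :: 'n set"] by auto
  have inj: "h i = h j \<longleftrightarrow> i = j" for i j
    using h by (auto simp: bij_betw_def inj_eq)
  \<comment> \<open>The form of \<open>s\<close> adds up the coordinates in \<open>A s\<close>. That
    of \<open>unit_vec i\<close> takes on \<open>all_ones\<close> the parity of \<open>h i\<close>,
    so that of \<open>all_ones\<close> must be 1 at \<open>unit_vec i\<close> exactly when
    \<open>h i\<close> is even. Vectors that are not generators get the empty set.\<close>
  define A :: "bit ^ 'n \<Rightarrow> 'n set"
    where "A s = (if s = all_ones then {j. even (h j)} else {j. \<exists>i. s = unit_vec i \<and> h j < h i})"
      for s
  define \<beta> :: "bit ^ 'n \<Rightarrow> bit ^ 'n \<Rightarrow> bit" where "\<beta> s u = (\<Sum>j\<in>A s. u $ j)" for s u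
  have ne: "unit_vec i \<noteq> (all_ones :: bit ^ 'n)" for i
    using all_ones_notin_range_unit_vec[OF card_ge_2] by (metis rangeI)
  have A_unit: "A (unit_vec i) = {j. h j < h i}" for i
    using ne by (auto simp: A_def)
  have A_ones: "A all_ones = {j. even (h j)}"
    by (simp add: A_def)
  have \<beta>_unit: "\<beta> s (unit_vec i) = of_bool (i \<in> A s)" for s i
    by (simp add: \<beta>_def unit_vec_nth of_bool_def)
  have \<beta>_ones: "\<beta> s all_ones = of_nat (card (A s))" for s
    by (simp add: \<beta>_def all_ones_nth)
  have card_image_h: "card {j. P (h j)} = card {k \<in> {0..<CARD('n)}. P k}" for P
  proof -
    have "h ` {j. P (h j)} = {k \<in> {0..<CARD('n)}. P k}"
      using bij_betw_imp_surj_on[OF h] by auto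
    then show ?thesis
      using card_image[of h "{j. P (h j)}"] h by (metis bij_betw_def inj_on_subset subset_UNIV)
  qed
  have card_below: "card {j. h j < h i} = h i" for i
  proof -
    have "h i < CARD('n)"
      using bij_betwE[OF h] by auto
    then have "{k \<in> {0..<CARD('n)}. k < h i} = {0..<h i}"
      by auto
    then show ?thesis
      using card_image_h[of "\<lambda>k. k < h i"] by simp
  qed
  \<comment> \<open>Counting starts at the even number 0, hence the rounding up; this gives the size
    of \<open>A all_ones\<close>.\<close>
  have card_even: "card {k \<in> {0..<m}. even k} = (m + 1) div 2" for m :: nat
  proof (induction m)
    case (Suc m)
    have "{k \<in> {0..<Suc m}. even k} =
        (if even m then insert m {k \<in> {0..<m}. even k} else {k \<in> {0..<m}. even k})"
      by (auto simp: less_Suc_eq)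
    then show ?case
      using Suc by auto
  qed simp
  have unit_ones: "\<beta> (unit_vec i) all_ones + \<beta> all_ones (unit_vec i) = 1" for i
    by (simp add: \<beta>_unit \<beta>_ones A_unit A_ones card_below of_nat_bit)
  have unit_unit: "\<beta> (unit_vec i) (unit_vec j) + \<beta> (unit_vec j) (unit_vec i) = 1"
    if "i \<noteq> j" for i j
    using inj[of i j] that by (auto simp: \<beta>_unit A_unit)
  show ?thesis
  proof
    show "\<beta> s (u + v) = \<beta> s u + \<beta> s v" for s u v
      by (simp add: \<beta>_def sum.distrib)
    show "\<beta> s t + \<beta> t s = 1"
      if st: "s \<in> Q_plus_generators" "t \<in> Q_plus_generators" "s \<noteq> t" for s t
    proof -
      consider i where "s = unit_vec i" "t = all_ones" | i where "s = all_ones" "t = unit_vec i"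
        | i j where "s = unit_vec i" "t = unit_vec j" "i \<noteq> j"
        using st unfolding Q_plus_generators_def by blast
      then show ?thesis
        using unit_ones unit_unit by cases (simp_all add: add.commute[of "\<beta> all_ones _"])
    qed
    show "\<beta> (unit_vec i) (unit_vec i) = 0" for i
      by (simp add: \<beta>_unit A_unit)
    show "\<beta> all_ones all_ones = of_nat ((CARD('n) + 1) div 2)"
      by (simp only: \<beta>_ones A_ones card_image_h card_even)
  qed
qed

end

section \<open>Residues modulo 4 and the characterization\<close>

text \<open>Half of the product of \<open>n\<close> and \<open>n + 1\<close> is even iff 4 divides
  one of these coprime factors. The cases write the product as twice an explicitly even or odd
  number.\<close>

lemma even_choose_2_iff: "even ((n + 1) choose 2) \<longleftrightarrow> n mod 4 \<in> {0, 3 :: nat}"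
proof -
  define q where "q = n div 4"
  have n: "n = 4 * q + n mod 4"
    by (simp add: q_def)
  have "n mod 4 < 4"
    by simp
  then consider "n mod 4 = 0" | "n mod 4 = 1" | "n mod 4 = 2" | "n mod 4 = 3"
    by linarith
  then show ?thesis
  proof cases
    case 1
    then have "(n + 1) * n = 2 * (2 * (q * (4 * q + 1)))" using n by (simp add: algebra_simps)
    then show ?thesis using 1 by (simp add: choose_two)
  next
    case 2
    then have "(n + 1) * n = 2 * (2 * (q * (4 * q + 3)) + 1)" using n by (simp add: algebra_simps)
    then show ?thesis using 2 by (simp add: choose_two)
  next
    case 3
    then have "(n + 1) * n = 2 * (2 * (q * (4 * q + 5) + 1) + 1)" using n by (simp add: algebra_simps)
    then show ?thesis using 3 by (simp add: choose_two)
  next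
    case 4
    then have "(n + 1) * n = 2 * (2 * ((q + 1) * (4 * q + 3)))" using n by (simp add: algebra_simps)
    then show ?thesis using 4 by (simp add: choose_two)
  qed
qed

theorem proposition1p3:
  assumes "CARD('n::finite) \<ge> 2"
  shows "((\<exists>M. orthogonal_signing (Q_plus TYPE('n)) M) \<longleftrightarrow> CARD('n) mod 4 \<in> {0, 3}) \<and>
    (CARD('n) mod 4 \<in> {1, 2} \<longrightarrow>
      (\<exists>M. unitary_signing (Q_plus TYPE('n)) M) \<and>
      \<not> (\<exists>M. orthogonal_signing (Q_plus TYPE('n)) M))"
proof -
  obtain \<beta> :: "bit ^ 'n \<Rightarrow> bit ^ 'n \<Rightarrow> bit"
    where additive: "\<And>s u v. \<beta> s (u + v) = \<beta> s u + \<beta> s v"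
    and anticommute: "\<And>s t. s \<in> Q_plus_generators \<Longrightarrow> t \<in> Q_plus_generators \<Longrightarrow> s \<noteq> t \<Longrightarrow>
      \<beta> s t + \<beta> t s = 1"
    and diagonal: "\<And>i. \<beta> (unit_vec i) (unit_vec i) = 0"
      "\<beta> all_ones all_ones = of_nat ((CARD('n) + 1) div 2)"
    using exists_generator_form[OF assms] by metis
  have unitary: "\<exists>M. unitary_signing (Q_plus TYPE('n)) M"
    unfolding Q_plus_eq using unitary_signing_form[of Q_plus_generators \<beta>] additive anticommute
    by blast
  have orthogonal: "\<exists>M. orthogonal_signing (Q_plus TYPE('n)) M" if "CARD('n) mod 4 \<in> {0, 3}"
  proof -
    have "CARD('n) mod 4 = 0 \<or> CARD('n) mod 4 = 3"
      using that by simp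
    \<comment> \<open>This makes the phase of the all-ones translation 1.\<close>
    then have "even ((CARD('n) + 1) div 2)"
      by presburger
    then have "\<beta> s s = 0" if "s \<in> Q_plus_generators" for s
      using that diagonal unfolding Q_plus_generators_def by auto
    then show ?thesis
      unfolding Q_plus_eq using orthogonal_signing_form[of Q_plus_generators \<beta>] additive anticommute
      by blast
  qed
  \<comment> \<open>In dimension 3, where sums of generators are not unique, the residue 3 is
    already an allowed one.\<close>
  have "CARD('n) mod 4 \<in> {0, 3}" if "orthogonal_signing (Q_plus TYPE('n)) M" for M
  proof (cases "CARD('n) = 3")
    case False
    have "even (card (Q_plus_generators :: (bit ^ 'n) set) choose 2)"
      using that generators_unique_sums[OF assms False] sum_Q_plus_generators[OF assms]
      unfolding Q_plus_eq by (rule even_choose_2_if_orthogonal_signing)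
    then show ?thesis
      by (simp only: card_Q_plus_generators[OF assms] even_choose_2_iff)
  qed simp
  with orthogonal have iff: "(\<exists>M. orthogonal_signing (Q_plus TYPE('n)) M) \<longleftrightarrow> CARD('n) mod 4 \<in> {0, 3}"
    by metis
  show ?thesis
    unfolding iff using unitary by auto
qed

end
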